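(* Let $n \geq 8$ be even and $k \geq 3$ be an integer with $2k<n$ and $\gcd(n,k)=1$. Then $$6 \leq \sigma^{-}(P(n,k)) \leq n.$$
   Context: For $n \geq 3$, $k \geq 1$ with $2k<n$, the generalized Petersen graph $P(n,k)$ has vertex set $\{u_i, v_i : i=0,1,\dots,n-1\}$ and edge set $\{u_iu_{i+1},\ u_iv_i,\ v_iv_{i+k} : i=0,\dots,n-1\}$, subscripts read modulo $n$. For a simple connected graph $G$ of order $N$, the \textbf{rna} number $\sigma^{-}(G)$ is the minimum, over all bijections $f: V(G)\to\{1,2,\dots,N\}$, of the number of edges $uv$ of $G$ such that $f(u)$ and $f(v)$ have different parity. *)

theory Defs
  imports Main
begin

text \<open>
  An undirected graph is a pair of a vertex set and a set of unordered pairs of vertices, so that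
  every edge is counted once.
\<close>

type_synonym 'a ugraph = "'a set \<times> 'a set set"

definition verts :: "'a ugraph \<Rightarrow> 'a set" where
  "verts G = fst G"

definition edges :: "'a ugraph \<Rightarrow> 'a set set" where
  "edges G = snd G"

definition mixed_parity_edges :: "'a ugraph \<Rightarrow> ('a \<Rightarrow> nat) \<Rightarrow> 'a set set" where
  "mixed_parity_edges G f =
     {e \<in> edges G. \<exists>u v. e = {u, v} \<and> even (f u) \<noteq> even (f v)}"

text \<open>
  For a finite graph the set below is finite and nonempty, so \<open>Min\<close> is a genuine minimum.
\<close>

definition rna_number :: "'a ugraph \<Rightarrow> nat" where
  "rna_number G =
     Min {card (mixed_parity_edges G f) | f. bij_betw f (verts G) {1..card (verts G)}}"

datatype gp_vertex = U nat | V nat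

definition gen_petersen :: "nat \<Rightarrow> nat \<Rightarrow> gp_vertex ugraph" where
  "gen_petersen n k =
     (U ` {..<n} \<union> V ` {..<n},
      {{U i, U ((i + 1) mod n)} | i. i < n} \<union>
      {{U i, V i} | i. i < n} \<union>
      {{V i, V ((i + k) mod n)} | i. i < n})"

lemma gen_petersen_edge:
  assumes "3 \<le> n" "1 \<le> k" "2 * k < n" "e \<in> edges (gen_petersen n k)"
  shows "e \<subseteq> verts (gen_petersen n k)" and "card e = 2"
proof -
  have shift: "i \<noteq> (i + d) mod n" if "i < n" "1 \<le> d" "d < n" for i d
    using that by (cases "i + d < n") (auto simp: mod_if)
  show "e \<subseteq> verts (gen_petersen n k)"
    using assms by (auto simp: gen_petersen_def verts_def edges_def)
  show "card e = 2"
    using assms shift[of _ 1] shift[of _ k]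
    by (auto simp: gen_petersen_def edges_def card_insert_if)
qed

end

theory Submission
  imports Defs "HOL-Number_Theory.Cong"
begin

text \<open>
  Let \<open>A\<close> and \<open>B\<close> be the index sets of the outer and inner vertices with even label, so
  \<open>|A| + |B| = n\<close>. Each of the outer and inner cycles is left by its set as often as it is entered,
  and \<open>|A \<triangle> B|\<close> is even. If one cycle is monochromatic, then so is the other, with the
  opposite parity, and all \<open>n\<close> spokes are mixed. Otherwise each cycle has at least two
  mixed edges, so the bound can fail only if \<open>A = B\<close> has \<open>n/2\<close> elements and is left exactly once
  by both cycles. Then \<open>A\<close> is an arc of the outer cycle; the shift by \<open>k\<close> moves the last two
  elements of this arc out of it, a contradiction. For the upper bound give all outer vertices
  even labels.
\<close>

definition shift_exits :: "nat \<Rightarrow> nat \<Rightarrow> nat set \<Rightarrow> nat set" where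
  "shift_exits n d A = {i \<in> A. (i + d) mod n \<notin> A}"

definition shift_entries :: "nat \<Rightarrow> nat \<Rightarrow> nat set \<Rightarrow> nat set" where
  "shift_entries n d A = {i. i < n \<and> i \<notin> A \<and> (i + d) mod n \<in> A}"

lemma inj_on_shift_mod: "inj_on (\<lambda>i. (i + d) mod n) {..<n::nat}"
proof (rule inj_onI)
  fix i j assume ij: "i \<in> {..<n}" "j \<in> {..<n}" and "(i + d) mod n = (j + d) mod n"
  then have "[i + d = j + d] (mod n)" by (simp add: cong_def)
  then have "[i = j] (mod n)" by (simp only: cong_add_rcancel_nat)
  with ij show "i = j" by (simp add: cong_def)
qed

lemma bij_betw_shift_mod:
  assumes "0 < (n::nat)"
  shows "bij_betw (\<lambda>i. (i + d) mod n) {..<n} {..<n}"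
proof -
  have "(\<lambda>i. (i + d) mod n) ` {..<n} = {..<n}"
    by (rule endo_inj_surj) (use assms inj_on_shift_mod in auto)
  then show ?thesis by (simp add: bij_betw_def inj_on_shift_mod)
qed

lemma card_shift_exits_eq_entries:
  assumes "A \<subseteq> {..<n}"
  shows "card (shift_exits n d A) = card (shift_entries n d A)"
proof (cases "n = 0")
  case True
  with assms show ?thesis by (simp add: shift_exits_def shift_entries_def)
next
  case False
  define P where "P = {i. i < n \<and> (i + d) mod n \<in> A}"
  have fin: "finite A" "finite P" using assms finite_subset by (auto simp: P_def)
  have bij: "bij_betw (\<lambda>i. (i + d) mod n) {..<n} {..<n}" using False bij_betw_shift_mod by simp
  have "(\<lambda>i. (i + d) mod n) ` P = A"
  proof
    show "A \<subseteq> (\<lambda>i. (i + d) mod n) ` P"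
    proof
      fix x assume x: "x \<in> A"
      then have "x \<in> (\<lambda>i. (i + d) mod n) ` {..<n}"
        using bij assms by (auto simp: bij_betw_imp_surj_on)
      then obtain i where "i < n" "x = (i + d) mod n" by auto
      with x show "x \<in> (\<lambda>i. (i + d) mod n) ` P" by (auto simp: P_def)
    qed
  qed (auto simp: P_def)
  moreover have "inj_on (\<lambda>i. (i + d) mod n) P"
    by (rule inj_on_subset[OF inj_on_shift_mod]) (auto simp: P_def)
  ultimately have "card P = card A" by (metis card_image)
  moreover have "shift_exits n d A = A - P" "shift_entries n d A = P - A"
    using assms by (auto simp: shift_exits_def shift_entries_def P_def)
  moreover have "card (A - P) + card (A \<inter> P) = card A" "card (P - A) + card (A \<inter> P) = card P"
    using fin by (metis card_Int_Diff add.commute Int_commute)+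
  ultimately show ?thesis by simp
qed

lemma shift_exits_empty:
  assumes "A \<subseteq> {..<n}" "coprime n d" "shift_exits n d A = {}"
  shows "A = {} \<or> A = {..<n}"
proof (rule disjCI)
  assume "A \<noteq> {..<n}"
  show "A = {}"
  proof (rule ccontr)
    assume "A \<noteq> {}"
    then obtain i where i: "i \<in> A" by blast
    then have n: "i < n" using assms(1) by auto
    have step: "(i + s * d) mod n \<in> A" for s
    proof (induction s)
      case 0 then show ?case using i n by simp
    next
      case (Suc s)
      then have "((i + s * d) mod n + d) mod n \<in> A"
        using assms(3) by (auto simp: shift_exits_def)
      then show ?case by (simp add: mod_simps algebra_simps)
    qed
    obtain y where y: "[d * y = 1] (mod n)"
      using assms(2) cong_solve_coprime_nat[of d n] by (auto simp: coprime_commute)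
    have "j \<in> A" if "j < n" for j
    proof -
      have "[d * y * (j + (n - i)) = 1 * (j + (n - i))] (mod n)"
        using y by (rule cong_mult) simp
      then have "[i + d * y * (j + (n - i)) = i + (j + (n - i))] (mod n)"
        using cong_add[OF cong_refl] by simp
      also have "i + (j + (n - i)) = j + n" using n by simp
      finally have "(i + (y * (j + (n - i))) * d) mod n = j"
        using that by (simp add: cong_def mult_ac)
      with step[of "y * (j + (n - i))"] show ?thesis by simp
    qed
    with assms(1) \<open>A \<noteq> {..<n}\<close> show False by auto
  qed
qed

lemma half_arc_two_exits:
  assumes A: "A \<subseteq> {..<n}" "2 * card A = n" and k: "2 \<le> k" "2 * k \<le> n"
    and one: "card (shift_exits n 1 A) = 1"
  shows "2 \<le> card (shift_exits n k A)"
proof -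
  obtain j where j: "shift_exits n 1 A = {j}" using one card_1_singletonE by blast
  then have jA: "j \<in> A" "(j + 1) mod n \<notin> A" and jn: "j < n"
    using A by (auto simp: shift_exits_def)
  \<comment> \<open>Read the cycle starting right after its only exit: membership in \<open>A\<close> is then monotone.\<close>
  define p where "p s = (j + 1 + s) mod n" for s
  have inj: "inj_on p {..<n}"
    using inj_on_shift_mod[of "j + 1" n] by (simp add: p_def[abs_def] add_ac)
  have "bij_betw p {..<n} {..<n}"
    using bij_betw_shift_mod[of n "j + 1"] jn by (simp add: p_def[abs_def] add_ac)
  then have surj: "p ` {..<n} = {..<n}" by (simp add: bij_betw_def)
  have last: "p (n - 1) = j" using jn by (simp add: p_def)
  have step: "p (Suc s) \<in> A" if "p s \<in> A" "Suc s < n" for s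
  proof -
    have "p s \<noteq> j"
      using inj_onD[OF inj, of s "n - 1"] last that by auto
    with that j have "(p s + 1) mod n \<in> A" by (auto simp: shift_exits_def)
    then show ?thesis by (simp add: p_def mod_simps)
  qed
  have mono: "p t \<in> A" if "p s \<in> A" "s \<le> t" "t < n" for s t
    using that(2,3,1) by (induction t rule: dec_induct) (use step in auto)
  have low: "p s \<notin> A" if "s < k" for s
  proof
    assume "p s \<in> A"
    then have "p ` {s..<n} \<subseteq> A" using mono by auto
    then have "card (p ` {s..<n}) \<le> card A" using A finite_subset card_mono by blast
    moreover have "card (p ` {s..<n}) = n - s"
      by (subst card_image) (auto intro: inj_on_subset[OF inj])
    ultimately show False using that A(2) k by linarith
  qed
  have high: "p (n - 2) \<in> A"
  proof (rule ccontr)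
    assume no: "p (n - 2) \<notin> A"
    have "A \<subseteq> {j}"
    proof
      fix x assume x: "x \<in> A"
      then obtain s where s: "s < n" "x = p s" using surj A by blast
      then have "\<not> s \<le> n - 2" using no mono[of s "n - 2"] x by auto
      then have "s = n - 1" using s by auto
      then show "x \<in> {j}" using s last by simp
    qed
    then have "card A \<le> 1" using card_mono[of "{j}" A] by simp
    then show False using A k by linarith
  qed
  have wrap: "(p (n - r) + k) mod n = p (k - r)" if "r \<le> k" for r
  proof -
    have "(p (n - r) + k) mod n = (j + 1 + (n - r) + k) mod n" by (simp add: p_def mod_simps)
    also have "j + 1 + (n - r) + k = j + 1 + (k - r) + n" using that k by simp
    finally show ?thesis by (simp only: p_def mod_add_self2)
  qed
  have "{p (n - 1), p (n - 2)} \<subseteq> shift_exits n k A"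
    using wrap[of 1] wrap[of 2] low[of "k - 1"] low[of "k - 2"] high last jA k
    by (simp add: shift_exits_def)
  moreover have "p (n - 1) \<noteq> p (n - 2)"
    using inj_onD[OF inj, of "n - 1" "n - 2"] k by auto
  then have "card {p (n - 1), p (n - 2)} = 2" by simp
  moreover have "finite (shift_exits n k A)"
    using A finite_subset[of A "{..<n}"] by (simp add: shift_exits_def)
  ultimately show ?thesis by (metis card_mono)
qed

lemma complementary_sets_boundary_ge_6:
  assumes AB: "A \<subseteq> {..<n}" "B \<subseteq> {..<n}" "card A + card B = n"
    and n: "even n" "6 \<le> n" and k: "2 \<le> k" "2 * k \<le> n" "coprime n k"
  shows "6 \<le> 2 * card (shift_exits n 1 A) + 2 * card (shift_exits n k B)
               + card ((A - B) \<union> (B - A))"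
proof -
  have fin: "finite A" "finite B" using AB finite_subset by auto
  define D where "D = (A - B) \<union> (B - A)"
  have "card D = card (A - B) + card (B - A)"
    unfolding D_def using fin by (intro card_Un_disjoint) auto
  moreover have "card (A - B) + card (A \<inter> B) = card A" "card (B - A) + card (A \<inter> B) = card B"
    using fin by (metis card_Int_Diff add.commute Int_commute)+
  ultimately have D: "card D + 2 * card (A \<inter> B) = n" using AB by simp
  then have evD: "even (card D)" using n by presburger
  have finX: "finite (shift_exits n 1 A)" "finite (shift_exits n k B)"
    using fin by (auto simp: shift_exits_def)
  show ?thesis
  proof (cases "shift_exits n 1 A = {} \<or> shift_exits n k B = {}")
    case True
    then have "A = {} \<or> A = {..<n} \<or> B = {} \<or> B = {..<n}"
      using shift_exits_empty[of A n 1] shift_exits_empty[of B n k] AB k by auto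
    then have "card A = 0 \<or> card A = n \<or> card B = 0 \<or> card B = n" by auto
    then have "card A = 0 \<or> card B = 0" using AB(3) by linarith
    then have "A = {} \<or> B = {}" using fin by simp
    then have "A \<inter> B = {}" by auto
    then show ?thesis using D n by (simp add: D_def)
  next
    case False
    then have pos: "1 \<le> card (shift_exits n 1 A)" "1 \<le> card (shift_exits n k B)"
      using finX by (auto simp: Suc_le_eq card_gt_0_iff)
    show ?thesis
    proof (cases "D = {}")
      case True
      then have "A = B" by (auto simp: D_def)
      then show ?thesis
        using half_arc_two_exits[of A n k] AB k pos by (cases "card (shift_exits n 1 A) = 1") auto
    next
      case False
      then have "card D \<noteq> 0" using fin by (simp add: D_def)
      with evD have "2 \<le> card D" by presburger
      then show ?thesis using pos by (simp add: D_def)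
    qed
  qed
qed

lemma inj_on_shift_pair:
  assumes "inj c" "2 * d < (n::nat)" "0 < d"
  shows "inj_on (\<lambda>i. {c i, c ((i + d) mod n)}) {..<n}"
proof (rule inj_onI)
  fix i j assume ij: "i \<in> {..<n}" "j \<in> {..<n}"
    and "{c i, c ((i + d) mod n)} = {c j, c ((j + d) mod n)}"
  then have "i = j \<or> (i = (j + d) mod n \<and> j = (i + d) mod n)"
    using assms(1) by (auto simp: doubleton_eq_iff inj_eq)
  moreover have False if "i = (j + d) mod n" "j = (i + d) mod n"
  proof -
    have "i mod n = ((i + d) mod n + d) mod n" using that ij by simp
    also have "\<dots> = (i + 2 * d) mod n" by (simp add: mod_add_left_eq mult_2 add.assoc)
    finally have "[i + 2 * d = i] (mod n)" by (simp add: cong_def)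
    then have "n dvd 2 * d" by (simp add: cong_add_lcancel_0_nat cong_0_iff)
    then show False using assms(2,3) by (auto dest: dvd_imp_le)
  qed
  ultimately show "i = j" by blast
qed

lemma bij_betw_gen_petersen_labelling:
  defines "g \<equiv> case_gp_vertex (\<lambda>i. 2 * i + 2) (\<lambda>i. 2 * i + 1)"
  shows "bij_betw g (verts (gen_petersen n k)) {1..2 * n}"
proof -
  have "inj_on g (U ` {..<n} \<union> V ` {..<n})"
    by (auto simp: inj_on_def g_def) presburger+
  moreover have "g ` (U ` {..<n} \<union> V ` {..<n}) = {1..2 * n}"
  proof
    show "{1..2 * n} \<subseteq> g ` (U ` {..<n} \<union> V ` {..<n})"
    proof
      fix x assume x: "x \<in> {1..2 * n}"
      show "x \<in> g ` (U ` {..<n} \<union> V ` {..<n})"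
      proof (cases "even x")
        case True
        then have "x = g (U (x div 2 - 1))" "x div 2 - 1 < n" using x by (auto simp: g_def)
        then show ?thesis by blast
      next
        case False
        then have "x = g (V (x div 2))" "x div 2 < n" using x by (auto simp: g_def elim!: oddE)
        then show ?thesis by blast
      qed
    qed
  qed (auto simp: g_def)
  ultimately show ?thesis by (simp add: bij_betw_def verts_def gen_petersen_def)
qed

lemma card_verts_gen_petersen: "card (verts (gen_petersen n k)) = 2 * n"
  using bij_betw_same_card[OF bij_betw_gen_petersen_labelling[of n k]] by simp

lemma finite_edges_gen_petersen: "finite (edges (gen_petersen n k))"
  by (simp add: edges_def gen_petersen_def)

lemma card_mixed_parity_edges_gen_petersen_ge:
  assumes n: "0 < k" "2 * k < n" and f: "bij_betw f (verts (gen_petersen n k)) {1..2 * n}"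
  defines "A \<equiv> {i. i < n \<and> even (f (U i))}" and "B \<equiv> {i. i < n \<and> even (f (V i))}"
  shows "card A + card B = n"
    and "2 * card (shift_exits n 1 A) + 2 * card (shift_exits n k B) + card ((A - B) \<union> (B - A))
          \<le> card (mixed_parity_edges (gen_petersen n k) f)"
proof -
  let ?W = "verts (gen_petersen n k)"
  have W: "?W = U ` {..<n} \<union> V ` {..<n}" by (simp add: verts_def gen_petersen_def)
  have sub: "A \<subseteq> {..<n}" "B \<subseteq> {..<n}" by (auto simp: A_def B_def)
  then have fin: "finite A" "finite B" using finite_subset by auto
  have "f ` (U ` A \<union> V ` B) = {x \<in> {1..2 * n}. even x}"
  proof -
    have "U ` A \<union> V ` B = {w \<in> ?W. even (f w)}" by (auto simp: W A_def B_def)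
    then show ?thesis using f unfolding bij_betw_def by auto
  qed
  also have "\<dots> = (\<lambda>i. 2 * i) ` {1..n}" by (auto elim!: evenE)
  finally have "card (f ` (U ` A \<union> V ` B)) = n" by (simp add: card_image inj_on_def)
  moreover have "inj_on f (U ` A \<union> V ` B)"
    by (rule inj_on_subset[of f ?W]) (use f sub in \<open>auto simp: bij_betw_def W\<close>)
  moreover have "card (U ` A \<union> V ` B) = card A + card B"
    using fin by (subst card_Un_disjoint) (auto simp: card_image inj_on_def)
  ultimately show "card A + card B = n" by (simp add: card_image)

  let ?M = "mixed_parity_edges (gen_petersen n k) f"
  let ?u = "\<lambda>i. {U i, U ((i + 1) mod n)}" and ?v = "\<lambda>i. {V i, V ((i + k) mod n)}"
    and ?s = "\<lambda>i. {U i, V i}"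
  let ?X = "shift_exits n 1 A \<union> shift_entries n 1 A"
    and ?Y = "shift_exits n k B \<union> shift_entries n k B" and ?D = "(A - B) \<union> (B - A)"
  have npos: "0 < n" using n by simp
  have X: "?X = {i. i < n \<and> even (f (U i)) \<noteq> even (f (U ((i + 1) mod n)))}"
    using npos by (auto simp: shift_exits_def shift_entries_def A_def)
  have Y: "?Y = {i. i < n \<and> even (f (V i)) \<noteq> even (f (V ((i + k) mod n)))}"
    using npos by (auto simp: shift_exits_def shift_entries_def B_def)
  have cardX: "card (shift_exits n d C \<union> shift_entries n d C) = 2 * card (shift_exits n d C)"
    if "C \<subseteq> {..<n}" for d C
  proof -
    have "finite C" using that finite_subset by auto
    then have "card (shift_exits n d C \<union> shift_entries n d C)
        = card (shift_exits n d C) + card (shift_entries n d C)"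
      by (intro card_Un_disjoint) (auto simp: shift_exits_def shift_entries_def)
    then show ?thesis using card_shift_exits_eq_entries[OF that, of d] by simp
  qed
  have finXY: "finite ?X" "finite ?Y" unfolding X Y by auto
  have "inj_on ?u ?X"
    by (rule inj_on_subset[OF inj_on_shift_pair[of U 1 n]]) (use n X in \<open>auto simp: inj_def\<close>)
  then have cu: "card (?u ` ?X) = 2 * card (shift_exits n 1 A)"
    using cardX[OF sub(1), of 1] by (simp only: card_image)
  have "inj_on ?v ?Y"
    by (rule inj_on_subset[OF inj_on_shift_pair[of V k n]]) (use n Y in \<open>auto simp: inj_def\<close>)
  then have cv: "card (?v ` ?Y) = 2 * card (shift_exits n k B)"
    using cardX[OF sub(2), of k] by (simp only: card_image)
  have "inj_on ?s ?D" by (auto simp: inj_on_def doubleton_eq_iff)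
  then have cs: "card (?s ` ?D) = card ?D" by (rule card_image)
  have "card (?u ` ?X \<union> ?v ` ?Y \<union> ?s ` ?D) = card (?u ` ?X \<union> ?v ` ?Y) + card (?s ` ?D)"
    using finXY fin by (intro card_Un_disjoint) (auto simp: doubleton_eq_iff)
  also have "card (?u ` ?X \<union> ?v ` ?Y) = card (?u ` ?X) + card (?v ` ?Y)"
    using finXY by (intro card_Un_disjoint) (auto simp: doubleton_eq_iff)
  finally have cardM: "card (?u ` ?X \<union> ?v ` ?Y \<union> ?s ` ?D)
      = 2 * card (shift_exits n 1 A) + 2 * card (shift_exits n k B) + card ?D"
    by (simp only: cu cv cs)
  have subM: "?u ` ?X \<union> ?v ` ?Y \<union> ?s ` ?D \<subseteq> ?M"
  proof (intro Un_least)
    show "?u ` ?X \<subseteq> ?M" unfolding X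
      by (auto simp: mixed_parity_edges_def edges_def gen_petersen_def)
    show "?v ` ?Y \<subseteq> ?M" unfolding Y
      by (auto simp: mixed_parity_edges_def edges_def gen_petersen_def)
    show "?s ` ?D \<subseteq> ?M"
      by (auto simp: A_def B_def mixed_parity_edges_def edges_def gen_petersen_def)
  qed
  have finM: "finite ?M"
    using finite_edges_gen_petersen by (simp add: mixed_parity_edges_def)
  show "2 * card (shift_exits n 1 A) + 2 * card (shift_exits n k B) + card ?D
      \<le> card ?M" using card_mono[OF finM subM] by (simp only: cardM)
qed

theorem theorem4p5:
  fixes n k :: nat
  assumes "n \<ge> 8" and "even n" and "k \<ge> 3" and "2 * k < n" and "gcd n k = 1"
  shows "6 \<le> rna_number (gen_petersen n k) \<and> rna_number (gen_petersen n k) \<le> n"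
proof -
  let ?G = "gen_petersen n k"
  let ?S = "{card (mixed_parity_edges ?G f) | f. bij_betw f (verts ?G) {1..card (verts ?G)}}"
  define g where "g = case_gp_vertex (\<lambda>i. 2 * i + 2) (\<lambda>i. 2 * i + 1)"
  have g: "bij_betw g (verts ?G) {1..card (verts ?G)}"
    using bij_betw_gen_petersen_labelling by (simp add: g_def card_verts_gen_petersen)
  have "?S \<subseteq> {..card (edges ?G)}"
    by (auto simp: mixed_parity_edges_def intro!: card_mono finite_edges_gen_petersen)
  then have fin: "finite ?S" by (rule finite_subset) simp
  have "6 \<le> x" if "x \<in> ?S" for x
  proof -
    from that obtain f where x: "x = card (mixed_parity_edges ?G f)"
      and f: "bij_betw f (verts ?G) {1..2 * n}" by (auto simp: card_verts_gen_petersen)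
    let ?A = "{i. i < n \<and> even (f (U i))}" and ?B = "{i. i < n \<and> even (f (V i))}"
    have "6 \<le> 2 * card (shift_exits n 1 ?A) + 2 * card (shift_exits n k ?B)
                + card ((?A - ?B) \<union> (?B - ?A))"
      using assms card_mixed_parity_edges_gen_petersen_ge(1)[OF _ _ f]
      by (intro complementary_sets_boundary_ge_6) (auto simp: coprime_iff_gcd_eq_1)
    also have "\<dots> \<le> x"
      unfolding x using assms by (intro card_mixed_parity_edges_gen_petersen_ge(2)[OF _ _ f]) auto
    finally show ?thesis .
  qed
  then have "6 \<le> Min ?S" using fin g by (subst Min_ge_iff) blast+
  moreover have "Min ?S \<le> n"
  proof -
    have "mixed_parity_edges ?G g \<subseteq> (\<lambda>i. {U i, V i}) ` {..<n}"
    proof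
      fix e assume "e \<in> mixed_parity_edges ?G g"
      then obtain u v where e: "e \<in> edges ?G" "u \<in> e" "v \<in> e" "even (g u) \<noteq> even (g v)"
        by (auto simp: mixed_parity_edges_def)
      then have "\<not> e \<subseteq> range U" "\<not> e \<subseteq> range V" by (auto simp: g_def)
      with e(1) show "e \<in> (\<lambda>i. {U i, V i}) ` {..<n}"
        by (auto simp: edges_def gen_petersen_def)
    qed
    then have "card (mixed_parity_edges ?G g) \<le> n"
      using surj_card_le[of "{..<n}"] by simp
    moreover have "Min ?S \<le> card (mixed_parity_edges ?G g)"
      using fin g by (intro Min_le) blast+
    ultimately show ?thesis by simp
  qed
  ultimately show ?thesis by (simp add: rna_number_def)
qed

end
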